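(* Let $G$ be a connected weighted undirected graph with modularity matrix $M$. Let $\mathcal{P}_\ast$ be a partition of $V$ with $q_G=q(\mathcal{P}_\ast)$, having minimal cardinality (number of sets) among all partitions attaining $q_G$, and entirely made of modules (that is, $Q(S)>0$ for every $S\in\mathcal{P}_\ast$). Then $\mathcal{P}_\ast$ contains no more than $k+1$ sets, where $k$ is the number of positive eigenvalues of $M$ (counted with multiplicity).
   Context: A graph $G=(V,E,\omega)$, $V=\{1,\dots,n\}$, is finite, undirected, connected, without multiple edges (loops are allowed), with edge weights $\omega:E\to\mathbb{R}^+$. Its adjacency matrix $A=(a_{ij})$ is the symmetric matrix with $a_{ij}=\omega(ij)>0$ if $ij\in E$ and $a_{ij}=0$ otherwise. The degree is $d_i=\sum_j a_{ij}$, $d=(d_1,\dots,d_n)^T$, $\mathrm{vol}\,G=\sum_i d_i$. The modularity matrix is $M=A-\frac{1}{\mathrm{vol}\,G}dd^T$. For $S\subseteq V$ with characteristic vector $\mathbf 1_S\in\{0,1\}^n$, the modularity of $S$ is $Q(S)=\mathbf 1_S^TM\mathbf 1_S$. A module is a subset (subgraph) having positive modularity. A partition of $V$ is a collection $\mathcal{P}=\{S_1,\dots,S_r\}$ of pairwise disjoint subsets with union $V$; its modularity is $q(\mathcal{P})=\frac{1}{\mathrm{vol}\,G}\sum_{i=1}^r Q(S_i)$, and $q_G=\max_{\mathcal{P}}q(\mathcal{P})$, the maximum being over all nontrivial partitions of $V$ (i.e. partitions other than $\{V\}$). *)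

theory Defs
  imports "Jordan_Normal_Form.Char_Poly" "HOL-Library.Disjoint_Sets"
begin

text \<open>
  The vertices are \<open>0, \<dots>, n - 1\<close>, matching the row and column indices of the matrices.
  An edge joining \<open>i\<close> and \<open>j\<close> is the set \<open>{i, j}\<close>, so that edges are undirected, there are
  no multiple edges, and a loop at \<open>i\<close> is the singleton \<open>{i}\<close>.
  Values of \<open>\<omega>\<close> outside \<open>E\<close> are irrelevant.
\<close>

locale connected_weighted_graph =
  fixes n :: nat and E :: "nat set set" and \<omega> :: "nat set \<Rightarrow> real"
  assumes nonempty: "n > 0"
    and edges: "e \<in> E \<Longrightarrow> \<exists>i<n. \<exists>j<n. e = {i, j}"
    and weight_pos: "e \<in> E \<Longrightarrow> \<omega> e > 0"
    and connected: "i < n \<Longrightarrow> j < n \<Longrightarrow> (i, j) \<in> {(u, v). {u, v} \<in> E}\<^sup>*"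

definition adjacency_mat :: "nat \<Rightarrow> nat set set \<Rightarrow> (nat set \<Rightarrow> real) \<Rightarrow> real mat" where
  "adjacency_mat n E \<omega> = mat n n (\<lambda>(i, j). if {i, j} \<in> E then \<omega> {i, j} else 0)"

definition degree_vec :: "nat \<Rightarrow> nat set set \<Rightarrow> (nat set \<Rightarrow> real) \<Rightarrow> real vec" where
  "degree_vec n E \<omega> = vec n (\<lambda>i. \<Sum>j<n. adjacency_mat n E \<omega> $$ (i, j))"

definition volume :: "nat \<Rightarrow> nat set set \<Rightarrow> (nat set \<Rightarrow> real) \<Rightarrow> real" where
  "volume n E \<omega> = (\<Sum>i<n. degree_vec n E \<omega> $ i)"

text \<open>
  The volume vanishes only for the single vertex without a loop; the quotients by the
  volume below are then zero.
\<close>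

definition modularity_mat :: "nat \<Rightarrow> nat set set \<Rightarrow> (nat set \<Rightarrow> real) \<Rightarrow> real mat" where
  "modularity_mat n E \<omega> = adjacency_mat n E \<omega> -
     (1 / volume n E \<omega>) \<cdot>\<^sub>m mat n n (\<lambda>(i, j). degree_vec n E \<omega> $ i * degree_vec n E \<omega> $ j)"

definition char_vec :: "nat \<Rightarrow> nat set \<Rightarrow> real vec" where
  "char_vec n S = vec n (\<lambda>i. if i \<in> S then 1 else 0)"

definition modularity :: "nat \<Rightarrow> nat set set \<Rightarrow> (nat set \<Rightarrow> real) \<Rightarrow> nat set \<Rightarrow> real" where
  "modularity n E \<omega> S = char_vec n S \<bullet> (modularity_mat n E \<omega> *\<^sub>v char_vec n S)"

definition is_module :: "nat \<Rightarrow> nat set set \<Rightarrow> (nat set \<Rightarrow> real) \<Rightarrow> nat set \<Rightarrow> bool" where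
  "is_module n E \<omega> S \<longleftrightarrow> S \<subseteq> {..<n} \<and> modularity n E \<omega> S > 0"

definition partition_modularity ::
    "nat \<Rightarrow> nat set set \<Rightarrow> (nat set \<Rightarrow> real) \<Rightarrow> nat set set \<Rightarrow> real" where
  "partition_modularity n E \<omega> P = (1 / volume n E \<omega>) * (\<Sum>S\<in>P. modularity n E \<omega> S)"

text \<open>
  A maximum over a finite set, which is nonempty unless the graph has only one vertex
  (then the value is unspecified).
\<close>

definition max_modularity :: "nat \<Rightarrow> nat set set \<Rightarrow> (nat set \<Rightarrow> real) \<Rightarrow> real" where
  "max_modularity n E \<omega> =
     Max (partition_modularity n E \<omega> ` {P. partition_on {..<n} P \<and> P \<noteq> {{..<n}}})"

text \<open>Algebraic multiplicities, i.e. orders as roots of the characteristic polynomial.\<close>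

definition num_pos_eigenvalues :: "real mat \<Rightarrow> nat" where
  "num_pos_eigenvalues A = (\<Sum>x \<in> {x. eigenvalue A x \<and> x > 0}. order x (char_poly A))"

end

theory Submission
  imports Defs
begin

text \<open>
  Let \<open>b S T\<close> be the sum of the entries \<open>M\<^sub>i\<^sub>j\<close> of the modularity matrix over \<open>i\<close> in \<open>S\<close> and
  \<open>j\<close> in \<open>T\<close>, where \<open>S\<close> and \<open>T\<close> are blocks of the given partition. Merging two blocks changes
  the total modularity by \<open>2 b S T\<close>. Since the partition is optimal with as few blocks as possible, and
  all its blocks are modules, \<open>b S T < 0\<close> for all pairs of different blocks
  (\<open>block_sum_neg_if_optimal_minimal\<close>).

  Moreover the rows of the modularity matrix sum to zero, hence so do those of \<open>b\<close>. A symmetric matrix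
  with negative off-diagonal entries and zero row sums is the Laplacian of a weighted complete graph,
  and its quadratic form is positive except on constant functions (\<open>laplacian_form_pos\<close>). The
  modularity matrix is therefore positive definite on the space of vectors that are constant on each block
  and vanish on one chosen block (\<open>positive_on_block_constant_vectors\<close>). The dimension of this space
  is one less than the number of blocks, and it cannot exceed the number of positive eigenvalues
  (\<open>positive_definite_subspace_dim_le\<close>).

  The last fact comes from orthogonal diagonalization of real symmetric matrices
  (\<open>real_spectral_theorem\<close>), which also identifies the count of positive eigenvalues by algebraic
  multiplicity with the number of positive entries of the diagonal matrix
  (\<open>num_pos_eigenvalues_diagonal\<close>).
\<close>

section \<open>Diagonalization of real symmetric matrices\<close>

lemma symmetric_scalar_prod:
  fixes M :: "real mat"
  assumes "M \<in> carrier_mat n n" "transpose_mat M = M" "x \<in> carrier_vec n" "y \<in> carrier_vec n"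
  shows "x \<bullet> (M *\<^sub>v y) = (M *\<^sub>v x) \<bullet> y"
  using transpose_vec_mult_scalar[OF assms(1) assms(4) assms(3)] assms by simp

lemma scalar_prod_self_eq_0_iff:
  fixes v :: "real vec"
  shows "v \<bullet> v = 0 \<longleftrightarrow> v = 0\<^sub>v (dim_vec v)"
proof
  assume "v \<bullet> v = 0"
  then show "v = 0\<^sub>v (dim_vec v)"
    by (intro eq_vecI) (auto simp: scalar_prod_def sum_nonneg_eq_0_iff)
next
  assume "v = 0\<^sub>v (dim_vec v)"
  then show "v \<bullet> v = 0"
    by (metis carrier_vec_dim_vec scalar_prod_left_zero)
qed

text \<open>
  The fundamental theorem of algebra gives an eigenvector \<open>x + i y\<close> with a complex eigenvalue
  \<open>l\<close>. Comparing \<open>x \<bullet> M y\<close> with \<open>M x \<bullet> y\<close> forces \<open>Im l = 0\<close>, so that \<open>x\<close> and \<open>y\<close> are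
  themselves real eigenvectors as soon as they are nonzero, and one of them is.
\<close>

lemma symmetric_real_unit_eigenvector:
  fixes M :: "real mat"
  assumes M: "M \<in> carrier_mat n n" and sym: "transpose_mat M = M" and n: "n > 0"
  obtains v e where "v \<in> carrier_vec n" "v \<bullet> v = 1" "M *\<^sub>v v = e \<cdot>\<^sub>v v"
proof -
  let ?C = "map_mat complex_of_real M"
  have C: "?C \<in> carrier_mat n n" using M by simp
  have "degree (char_poly ?C) = n" using degree_monic_char_poly[OF C] by simp
  then have "\<not> constant (poly (char_poly ?C))" using n by (simp add: constant_degree)
  then obtain l where "poly (char_poly ?C) l = 0" using fundamental_theorem_of_algebra by blast
  then have "eigenvalue ?C l" using eigenvalue_root_char_poly[OF C] by simp
  then obtain z where z: "z \<in> carrier_vec n" "z \<noteq> 0\<^sub>v n" "?C *\<^sub>v z = l \<cdot>\<^sub>v z"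
    unfolding eigenvalue_def eigenvector_def using M by auto
  define x where "x = vec n (\<lambda>i. Re (z $ i))"
  define y where "y = vec n (\<lambda>i. Im (z $ i))"
  have x: "x \<in> carrier_vec n" and y: "y \<in> carrier_vec n" by (auto simp: x_def y_def)
  have row: "(\<Sum>j<n. complex_of_real (M $$ (i, j)) * z $ j) = l * z $ i" if "i < n" for i
    using arg_cong[OF z(3), of "\<lambda>v. v $ i"] that z(1) M
    by (simp add: scalar_prod_def lessThan_atLeast0)
  have Mx: "M *\<^sub>v x = Re l \<cdot>\<^sub>v x - Im l \<cdot>\<^sub>v y"
  proof (rule eq_vecI)
    fix i assume "i < dim_vec (Re l \<cdot>\<^sub>v x - Im l \<cdot>\<^sub>v y)"
    then have i: "i < n" by (simp add: y_def)
    show "(M *\<^sub>v x) $ i = (Re l \<cdot>\<^sub>v x - Im l \<cdot>\<^sub>v y) $ i"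
      using arg_cong[OF row[OF i], of Re] i M
      by (simp add: scalar_prod_def lessThan_atLeast0 x_def y_def)
  qed (use M y in auto)
  have My: "M *\<^sub>v y = Im l \<cdot>\<^sub>v x + Re l \<cdot>\<^sub>v y"
  proof (rule eq_vecI)
    fix i assume "i < dim_vec (Im l \<cdot>\<^sub>v x + Re l \<cdot>\<^sub>v y)"
    then have i: "i < n" by (simp add: y_def)
    show "(M *\<^sub>v y) $ i = (Im l \<cdot>\<^sub>v x + Re l \<cdot>\<^sub>v y) $ i"
      using arg_cong[OF row[OF i], of Im] i M
      by (simp add: scalar_prod_def lessThan_atLeast0 x_def y_def)
  qed (use M y in auto)
  have xy: "x \<noteq> 0\<^sub>v n \<or> y \<noteq> 0\<^sub>v n"
  proof (rule ccontr)
    assume "\<not> ?thesis"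
    then have "x $ i = 0" "y $ i = 0" if "i < n" for i using that by simp_all
    then have "z $ i = 0" if "i < n" for i
      using that by (simp add: x_def y_def complex_eq_iff)
    then show False using z by (metis carrier_vecD eq_vecI index_zero_vec)
  qed
  have "x \<bullet> (M *\<^sub>v y) = (M *\<^sub>v x) \<bullet> y" by (rule symmetric_scalar_prod[OF M sym x y])
  then have "Im l * (x \<bullet> x) + Re l * (x \<bullet> y) = Re l * (x \<bullet> y) - Im l * (y \<bullet> y)"
    unfolding Mx My using x y
    by (simp add: scalar_prod_add_distrib[of _ n] minus_scalar_prod_distrib[of _ n])
  then have "Im l * (x \<bullet> x + y \<bullet> y) = 0" by (simp add: algebra_simps)
  moreover have "x \<bullet> x \<ge> 0" "y \<bullet> y \<ge> 0" by (auto simp: scalar_prod_def sum_nonneg)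
  moreover have "x \<bullet> x \<noteq> 0 \<or> y \<bullet> y \<noteq> 0"
    using xy scalar_prod_self_eq_0_iff[of x] scalar_prod_self_eq_0_iff[of y] x y by auto
  ultimately have "Im l = 0" by (smt (verit) mult_eq_0_iff)
  then have "M *\<^sub>v x = Re l \<cdot>\<^sub>v x" "M *\<^sub>v y = Re l \<cdot>\<^sub>v y" using Mx My x y by auto
  with xy x y obtain w where w: "w \<in> carrier_vec n" "w \<noteq> 0\<^sub>v n" "M *\<^sub>v w = Re l \<cdot>\<^sub>v w" by blast
  have pos: "w \<bullet> w > 0"
    using w scalar_prod_self_eq_0_iff[of w] sum_nonneg[of "{0..<n}" "\<lambda>i. w $ i * w $ i"]
    by (auto simp: scalar_prod_def less_le)
  define s where "s = 1 / sqrt (w \<bullet> w)"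
  have "(s \<cdot>\<^sub>v w) \<bullet> (s \<cdot>\<^sub>v w) = s * s * (w \<bullet> w)" using w(1) by simp
  also have "\<dots> = 1" using pos by (simp add: s_def)
  finally have "(s \<cdot>\<^sub>v w) \<bullet> (s \<cdot>\<^sub>v w) = 1" .
  moreover have "M *\<^sub>v (s \<cdot>\<^sub>v w) = Re l \<cdot>\<^sub>v (s \<cdot>\<^sub>v w)"
    using w M by (simp add: mult_mat_vec smult_smult_assoc mult.commute)
  ultimately show thesis using that[of "s \<cdot>\<^sub>v w" "Re l"] w(1) by simp
qed

text \<open>
  A Householder reflection that exchanges \<open>v\<close> and the first unit vector. Choosing a reflection
  rather than an arbitrary orthogonal matrix makes \<open>W\<close> its own transpose and inverse.
\<close>

lemma symmetric_orthogonal_with_first_column: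
  fixes v :: "real vec"
  assumes v: "v \<in> carrier_vec n" "v \<bullet> v = 1" and n: "n > 0"
  obtains W where "W \<in> carrier_mat n n" "transpose_mat W = W" "W * W = 1\<^sub>m n" "col W 0 = v"
proof -
  define u where "u = unit_vec n 0 - v"
  \<comment> \<open>The usual factor is \<open>2 / (u \<bullet> u)\<close>, and \<open>u \<bullet> u = 2 u\<^sub>0\<close> because \<open>v\<close> is a unit vector.
    If \<open>u = 0\<close>, then \<open>c\<close> is \<open>1 / 0 = 0\<close> and \<open>W\<close> is the identity, as it should be.\<close>
  define c where "c = 1 / u $ 0"
  define W where "W = mat n n (\<lambda>(i, j). (if i = j then 1 else 0) - c * u $ i * u $ j)"
  have u: "u \<in> carrier_vec n" using v by (auto simp: u_def)
  have "u \<bullet> u = unit_vec n 0 \<bullet> unit_vec n 0 - 2 * (unit_vec n 0 \<bullet> v) + v \<bullet> v"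
    unfolding u_def using v comm_scalar_prod[OF v(1), of "unit_vec n 0"]
    by (simp add: scalar_prod_minus_distrib[of _ n] minus_scalar_prod_distrib[of _ n])
  then have uu: "u \<bullet> u = 2 * u $ 0" using v n by (simp add: u_def)
  have u_zero: "u = 0\<^sub>v n" if "u $ 0 = 0"
    using uu that scalar_prod_self_eq_0_iff[of u] u by simp
  have cuu: "c * c * (u \<bullet> u) = 2 * c" by (simp add: c_def uu)
  have "W * W = 1\<^sub>m n"
  proof (rule eq_matI)
    fix i j assume "i < dim_row (1\<^sub>m n :: real mat)" "j < dim_col (1\<^sub>m n :: real mat)"
    then have ij: "i < n" "j < n" by auto
    have "(W * W) $$ (i, j) = (\<Sum>k<n. ((if i = k then 1 else 0) - c * u $ i * u $ k)
        * ((if k = j then 1 else 0) - c * u $ k * u $ j))"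
      using ij by (simp add: W_def scalar_prod_def lessThan_atLeast0)
    also have "\<dots> = (\<Sum>k<n. (if i = k then (if i = j then 1 else 0) else 0)
        - (if i = k then c * u $ i * u $ j else 0) - (if k = j then c * u $ i * u $ j else 0)
        + c * c * u $ i * u $ j * (u $ k * u $ k))"
      by (rule sum.cong) (auto simp: algebra_simps)
    also have "\<dots> = (if i = j then 1 else 0) - 2 * c * u $ i * u $ j
        + c * c * u $ i * u $ j * (\<Sum>k<n. u $ k * u $ k)"
      using ij by (simp add: sum.distrib sum_subtractf sum_distrib_left)
    also have "(\<Sum>k<n. u $ k * u $ k) = u \<bullet> u"
      using u by (simp add: scalar_prod_def lessThan_atLeast0)
    also have "c * c * u $ i * u $ j * (u \<bullet> u) = (c * c * (u \<bullet> u)) * u $ i * u $ j" by simp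
    finally show "(W * W) $$ (i, j) = 1\<^sub>m n $$ (i, j)" using ij by (simp add: cuu)
  qed (auto simp: W_def)
  moreover have "col W 0 = v"
  proof (rule eq_vecI)
    fix i assume "i < dim_vec v"
    then have i: "i < n" using v by simp
    show "col W 0 $ i = v $ i"
    proof (cases "u $ 0 = 0")
      case True
      then show ?thesis using i n v arg_cong[OF u_zero, of "\<lambda>v. v $ i"]
        by (simp add: W_def u_def split: if_splits)
    next
      case False
      then show ?thesis using i n v by (simp add: W_def c_def u_def)
    qed
  qed (use v in \<open>auto simp: W_def\<close>)
  moreover have "transpose_mat W = W" by (rule eq_matI) (auto simp: W_def)
  ultimately show thesis using that[of W] by (simp add: W_def)
qed

text \<open>
  Reflecting a unit eigenvector to the first coordinate axis turns the first column of \<open>M\<close>, and by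
  symmetry its first row, into a multiple of the unit vector. What remains is a symmetric matrix of
  size one less, to which the induction hypothesis applies.
\<close>

lemma real_spectral_theorem:
  fixes M :: "real mat"
  assumes "M \<in> carrier_mat n n" "transpose_mat M = M"
  shows "\<exists>U D. U \<in> carrier_mat n n \<and> D \<in> carrier_mat n n \<and> diagonal_mat D \<and>
    transpose_mat U * U = 1\<^sub>m n \<and> U * transpose_mat U = 1\<^sub>m n \<and> M = U * D * transpose_mat U"
  using assms
proof (induction n arbitrary: M)
  case 0
  then show ?case
    by (intro exI[of _ "1\<^sub>m 0"] exI[of _ M]) (auto simp: diagonal_mat_def)
next
  case (Suc n)
  note M = Suc.prems(1) and sym = Suc.prems(2)
  obtain v e where v: "v \<in> carrier_vec (Suc n)" "v \<bullet> v = 1" "M *\<^sub>v v = e \<cdot>\<^sub>v v"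
    using symmetric_real_unit_eigenvector[OF M sym] by blast
  obtain W where W: "W \<in> carrier_mat (Suc n) (Suc n)" "transpose_mat W = W"
    "W * W = 1\<^sub>m (Suc n)" "col W 0 = v"
    using symmetric_orthogonal_with_first_column[OF v(1,2)] by auto
  define A where "A = W * M * W"
  have A: "A \<in> carrier_mat (Suc n) (Suc n)" using W M by (auto simp: A_def)
  have A_sym: "transpose_mat A = A"
    unfolding A_def using W M sym
    by (simp add: transpose_mult[of _ "Suc n" "Suc n" _ "Suc n"]
        assoc_mult_mat[of _ "Suc n" "Suc n" _ "Suc n" _ "Suc n"])
  have "col A 0 = (W * M) *\<^sub>v col W 0"
    unfolding A_def by (rule col_mult2[of _ "Suc n" "Suc n" _ "Suc n"]) (use W(1) M in auto)
  also have "\<dots> = W *\<^sub>v (M *\<^sub>v col W 0)"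
    by (rule assoc_mult_mat_vec[of _ "Suc n" "Suc n" _ "Suc n"]) (use W(1,4) M v(1) in auto)
  also have "\<dots> = e \<cdot>\<^sub>v (W *\<^sub>v col W 0)"
    unfolding W(4) v(3) using W(1) v(1) by (simp add: mult_mat_vec)
  also have "W *\<^sub>v col W 0 = col (W * W) 0"
    by (rule col_mult2[symmetric, of _ "Suc n" "Suc n" _ "Suc n"]) (use W(1) in auto)
  finally have colA: "col A 0 = e \<cdot>\<^sub>v unit_vec (Suc n) 0" by (simp add: W(3))
  have A_col0: "A $$ (i, 0) = (if i = 0 then e else 0)" if "i < Suc n" for i
    using arg_cong[OF colA, of "\<lambda>v. v $ i"] that A by simp
  have A_row0: "A $$ (0, i) = (if i = 0 then e else 0)" if "i < Suc n" for i
    using A_col0[OF that] arg_cong[OF A_sym, of "\<lambda>B. B $$ (0, i)"] that A by simp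
  define A3 where "A3 = mat n n (\<lambda>(i, j). A $$ (Suc i, Suc j))"
  let ?E = "mat 1 1 (\<lambda>_. e)"
  have A_block: "A = four_block_mat ?E (0\<^sub>m 1 n) (0\<^sub>m n 1) A3"
  proof (rule eq_matI)
    fix i j
    assume "i < dim_row (four_block_mat ?E (0\<^sub>m 1 n) (0\<^sub>m n 1) A3)"
      "j < dim_col (four_block_mat ?E (0\<^sub>m 1 n) (0\<^sub>m n 1) A3)"
    then have "i < Suc n" "j < Suc n" by (simp_all add: A3_def)
    then show "A $$ (i, j) = four_block_mat ?E (0\<^sub>m 1 n) (0\<^sub>m n 1) A3 $$ (i, j)"
      using A_row0[of j] A_col0[of i] by (cases i; cases j) (simp_all add: A3_def)
  qed (use A in \<open>simp_all add: A3_def\<close>)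
  have A3_sym: "transpose_mat A3 = A3"
  proof (rule eq_matI)
    fix i j assume "i < dim_row A3" "j < dim_col A3"
    then show "transpose_mat A3 $$ (i, j) = A3 $$ (i, j)"
      using arg_cong[OF A_sym, of "\<lambda>B. B $$ (Suc i, Suc j)"] A by (simp add: A3_def)
  qed (auto simp: A3_def)
  have "A3 \<in> carrier_mat n n" by (simp add: A3_def)
  from Suc.IH[OF this A3_sym] obtain U3 D3 where
    U3: "U3 \<in> carrier_mat n n" "transpose_mat U3 * U3 = 1\<^sub>m n" "U3 * transpose_mat U3 = 1\<^sub>m n"
    and D3: "D3 \<in> carrier_mat n n" "diagonal_mat D3"
    and A3: "A3 = U3 * D3 * transpose_mat U3" by blast
  define V where "V = four_block_mat (1\<^sub>m 1) (0\<^sub>m 1 n) (0\<^sub>m n 1) U3"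
  define D where "D = four_block_mat ?E (0\<^sub>m 1 n) (0\<^sub>m n 1) D3"
  have V: "V \<in> carrier_mat (Suc n) (Suc n)" and D: "D \<in> carrier_mat (Suc n) (Suc n)"
    using four_block_carrier_mat[of "1\<^sub>m 1" 1 1 U3 n n] four_block_carrier_mat[of ?E 1 1 D3 n n] U3 D3
    by (simp_all add: V_def D_def)
  have Vt: "transpose_mat V = four_block_mat (1\<^sub>m 1) (0\<^sub>m 1 n) (0\<^sub>m n 1) (transpose_mat U3)"
    unfolding V_def using U3 by (subst transpose_four_block_mat[of _ 1 1 _ n _ n]) auto
  have one: "four_block_mat (1\<^sub>m 1) (0\<^sub>m 1 n) (0\<^sub>m n 1) (1\<^sub>m n) = (1\<^sub>m (Suc n) :: real mat)"
    by (rule eq_matI) auto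
  have VtV: "transpose_mat V * V = 1\<^sub>m (Suc n)"
    unfolding Vt unfolding V_def one[symmetric] using U3
    by (subst mult_four_block_mat[of _ 1 1 _ n _ n _ _ 1 _ n]) auto
  have VVt: "V * transpose_mat V = 1\<^sub>m (Suc n)"
    unfolding Vt unfolding V_def one[symmetric] using U3
    by (subst mult_four_block_mat[of _ 1 1 _ n _ n _ _ 1 _ n]) auto
  have VD: "V * D = four_block_mat ?E (0\<^sub>m 1 n) (0\<^sub>m n 1) (U3 * D3)"
    unfolding V_def D_def using U3 D3
    by (subst mult_four_block_mat[of _ 1 1 _ n _ n _ _ 1 _ n]) auto
  have A_eq: "A = V * D * transpose_mat V"
    unfolding VD Vt unfolding A_block A3 using U3 D3
    by (subst mult_four_block_mat[of _ 1 1 _ n _ n _ _ 1 _ n]) auto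
  note [simp] = transpose_mult[of _ "Suc n" "Suc n" _ "Suc n"]
  note assoc = assoc_mult_mat[of _ "Suc n" "Suc n" _ "Suc n" _ "Suc n"]
  have cancel_W: "W * (W * X) = X" if "X \<in> carrier_mat (Suc n) (Suc n)" for X
    using W(1,3) that assoc[of W W X] by simp
  have cancel_V: "transpose_mat V * (V * X) = X" "V * (transpose_mat V * X) = X"
    if "X \<in> carrier_mat (Suc n) (Suc n)" for X
    using V VtV VVt that assoc[of V "transpose_mat V" X] assoc[of "transpose_mat V" V X] by simp_all
  define U where "U = W * V"
  have U: "U \<in> carrier_mat (Suc n) (Suc n)" using W V by (auto simp: U_def)
  have Ut: "transpose_mat U = transpose_mat V * W" using W V by (simp add: U_def)
  have "M = W * (W * M * W) * W"
    using M W(1,3) by (simp add: assoc cancel_W)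
  also have "\<dots> = U * D * transpose_mat U"
    using M W(1) V D U unfolding A_def[symmetric] A_eq Ut by (simp add: U_def assoc)
  finally have "M = U * D * transpose_mat U" .
  moreover have "transpose_mat U * U = 1\<^sub>m (Suc n)" "U * transpose_mat U = 1\<^sub>m (Suc n)"
    unfolding Ut using W(1,3) V VtV VVt by (simp_all add: U_def assoc cancel_W cancel_V)
  moreover have "diagonal_mat D"
    using D3 by (auto simp: diagonal_mat_def D_def)
  ultimately show ?case using U D by blast
qed

section \<open>Positive eigenvalues and positive definite subspaces\<close>

lemma order_prod_list_linear_factors:
  fixes as :: "real list"
  shows "order x (\<Prod>a\<leftarrow>as. [:- a, 1:]) = count_list as x"
proof (induction as)
  case (Cons a as)
  have nz: "[:- a, 1:] * (\<Prod>a\<leftarrow>as. [:- a, 1:]) \<noteq> 0"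
    unfolding mult_eq_0_iff prod_list_zero_iff by auto
  have "order x [:- a, 1:] = (if a = x then 1 else 0)"
    using order_power_n_n[of a 1] by (auto intro: order_0I)
  then show ?case using Cons by (simp add: order_mult[OF nz] del: mult_pCons_left)
qed (simp add: order_0I)

text \<open>
  Similar matrices have the same characteristic polynomial, which for a diagonal matrix splits into
  linear factors given by the diagonal entries. The multiplicity of a root is therefore the number of
  times it occurs on the diagonal.
\<close>

lemma num_pos_eigenvalues_diagonal:
  fixes D :: "real mat"
  assumes M: "M \<in> carrier_mat n n" and D: "D \<in> carrier_mat n n" "diagonal_mat D"
    and "similar_mat M D"
  shows "num_pos_eigenvalues M = card {i. i < n \<and> D $$ (i, i) > 0}"
proof -
  have "upper_triangular D" using D by (auto simp: diagonal_mat_def upper_triangular_def)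
  then have cp: "char_poly M = (\<Prod>a\<leftarrow>diag_mat D. [:- a, 1:])"
    using char_poly_similar[OF \<open>similar_mat M D\<close>] char_poly_upper_triangular[OF D(1)] by simp
  have ev: "{x. eigenvalue M x \<and> x > 0} = {x \<in> set (diag_mat D). x > 0}"
    unfolding eigenvalue_root_char_poly[OF M] cp
    by (auto simp: poly_prod_list prod_list_zero_iff o_def)
  have "num_pos_eigenvalues M = (\<Sum>x\<in>{x \<in> set (diag_mat D). x > 0}. count_list (diag_mat D) x)"
    unfolding num_pos_eigenvalues_def ev cp order_prod_list_linear_factors ..
  also have "\<dots> = (\<Sum>x\<in>{x \<in> set (diag_mat D). x > 0}. card {i. i < n \<and> D $$ (i, i) = x})"
  proof (rule sum.cong)
    fix x
    have "count_list (diag_mat D) x = length (filter ((=) x) (diag_mat D))"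
      by (rule count_list_eq_length_filter)
    also have "\<dots> = card {i. i < n \<and> D $$ (i, i) = x}"
      using D by (auto simp: length_filter_conv_card diag_mat_def intro!: arg_cong[where f = card])
    finally show "count_list (diag_mat D) x = card {i. i < n \<and> D $$ (i, i) = x}" .
  qed simp
  also have "\<dots> = card (\<Union>x\<in>{x \<in> set (diag_mat D). x > 0}. {i. i < n \<and> D $$ (i, i) = x})"
    by (rule card_UN_disjoint[symmetric]) auto
  also have "(\<Union>x\<in>{x \<in> set (diag_mat D). x > 0}. {i. i < n \<and> D $$ (i, i) = x}) =
      {i. i < n \<and> D $$ (i, i) > 0}"
    using D by (auto simp: diag_mat_def)
  finally show ?thesis .
qed

text \<open>
  Padding the system with zero rows makes it square without changing its solutions, and a square
  matrix with a zero row is singular.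
\<close>

lemma fewer_equations_than_unknowns:
  fixes A :: "real mat"
  assumes A: "A \<in> carrier_mat k m" and "k < m"
  obtains c where "c \<in> carrier_vec m" "c \<noteq> 0\<^sub>v m" "A *\<^sub>v c = 0\<^sub>v k"
proof -
  define Z where "Z = mat\<^sub>r m m (\<lambda>i. if i = k then 0\<^sub>v m else if i < k then row A i else 0\<^sub>v m)"
  have Z: "Z \<in> carrier_mat m m" by (simp add: Z_def)
  have "det Z = 0" unfolding Z_def using A \<open>k < m\<close> by (intro det_row_0) auto
  then obtain c where c: "c \<in> carrier_vec m" "c \<noteq> 0\<^sub>v m" "Z *\<^sub>v c = 0\<^sub>v m"
    using det_0_iff_vec_prod_zero[OF Z] by auto
  have "A *\<^sub>v c = 0\<^sub>v k"
  proof (rule eq_vecI)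
    fix i assume "i < dim_vec (0\<^sub>v k :: real vec)"
    then have i: "i < k" by simp
    then have "row Z i = row A i" unfolding Z_def using \<open>k < m\<close> A by (subst row_mat_of_row_fun) auto
    then show "(A *\<^sub>v c) $ i = 0\<^sub>v k $ i"
      using arg_cong[OF c(3), of "\<lambda>v. v $ i"] i \<open>k < m\<close> A Z by simp
  qed (use A in auto)
  with c that show thesis by blast
qed

text \<open>
  One half of Sylvester's law of inertia. In orthonormal eigencoordinates \<open>y\<close> the form is
  \<open>\<Sum>i. d\<^sub>i y\<^sub>i\<^sup>2\<close>. If \<open>m\<close> exceeded the number of positive \<open>d\<^sub>i\<close>, the
  equations \<open>y\<^sub>i = 0\<close> for all \<open>i\<close> with \<open>d\<^sub>i > 0\<close> would have a nonzero solution in the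
  \<open>m\<close>-parameter family of vectors \<open>W c\<close>, and the form would not be positive there.
  Linear independence of the columns of \<open>W\<close> follows from the positivity hypothesis.
\<close>

lemma positive_definite_subspace_dim_le:
  fixes M :: "real mat"
  assumes M: "M \<in> carrier_mat n n" and sym: "transpose_mat M = M"
    and W: "W \<in> carrier_mat n m"
    and pos: "\<And>c. c \<in> carrier_vec m \<Longrightarrow> c \<noteq> 0\<^sub>v m \<Longrightarrow> (W *\<^sub>v c) \<bullet> (M *\<^sub>v (W *\<^sub>v c)) > 0"
  shows "m \<le> num_pos_eigenvalues M"
proof (rule ccontr)
  obtain U D where U: "U \<in> carrier_mat n n" "transpose_mat U * U = 1\<^sub>m n" "U * transpose_mat U = 1\<^sub>m n"
    and D: "D \<in> carrier_mat n n" "diagonal_mat D"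
    and M_eq: "M = U * D * transpose_mat U"
    using real_spectral_theorem[OF M sym] by blast
  have "similar_mat_wit M D U (transpose_mat U)"
    by (rule similar_mat_witI[OF U(3,2) M_eq]) (use M U D in auto)
  then have num: "num_pos_eigenvalues M = card {i. i < n \<and> D $$ (i, i) > 0}" (is "_ = card ?I")
    by (intro num_pos_eigenvalues_diagonal[OF M D]) (auto simp: similar_mat_def)
  define ps where "ps = sorted_list_of_set ?I"
  have ps: "set ps = ?I" "length ps = card ?I" by (auto simp: ps_def)
  assume "\<not> ?thesis"
  then have less: "length ps < m" using num ps by simp
  define Y where "Y = transpose_mat U * W"
  have Y: "Y \<in> carrier_mat n m" using U W by (auto simp: Y_def)
  let ?A = "mat (length ps) m (\<lambda>(i, j). Y $$ (ps ! i, j))"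
  obtain c where c: "c \<in> carrier_vec m" "c \<noteq> 0\<^sub>v m" "?A *\<^sub>v c = 0\<^sub>v (length ps)"
    by (rule fewer_equations_than_unknowns[OF mat_carrier less])
  define y where "y = Y *\<^sub>v c"
  have y: "y \<in> carrier_vec n" unfolding y_def by (rule mult_mat_vec_carrier[OF Y c(1)])
  have y_zero: "y $ i = 0" if i: "i \<in> ?I" for i
  proof -
    obtain a where a: "a < length ps" "ps ! a = i" using i unfolding ps(1)[symmetric] in_set_conv_nth by blast
    have "row ?A a = row Y i" by (rule eq_vecI) (use a i Y in simp_all)
    then have "y $ i = (?A *\<^sub>v c) $ a" using i a Y by (simp add: y_def)
    then show ?thesis using c(3) a by simp
  qed
  have "U *\<^sub>v y = (U * transpose_mat U * W) *\<^sub>v c"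
    using U(1) W c(1) by (simp add: y_def Y_def assoc_mult_mat[of _ n n _ n _ m] assoc_mult_mat_vec[of _ n n _ m])
  then have Wc: "W *\<^sub>v c = U *\<^sub>v y" using U(3) W by simp
  have Uy: "transpose_mat U *\<^sub>v (U *\<^sub>v y) = y"
    using U(1,2) y assoc_mult_mat_vec[of "transpose_mat U" n n U n y] by simp
  have "(W *\<^sub>v c) \<bullet> (M *\<^sub>v (W *\<^sub>v c)) = (U *\<^sub>v y) \<bullet> (U *\<^sub>v (D *\<^sub>v y))"
    unfolding Wc M_eq using U(1) D y
    by (simp add: assoc_mult_mat[of _ n n _ n _ n] assoc_mult_mat_vec[of _ n n _ n] Uy)
  also have "\<dots> = (transpose_mat U *\<^sub>v (U *\<^sub>v y)) \<bullet> (D *\<^sub>v y)"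
    using transpose_vec_mult_scalar[of U n n "D *\<^sub>v y" "U *\<^sub>v y"] U(1) D y by simp
  also have "\<dots> = (\<Sum>i<n. y $ i * (\<Sum>j<n. D $$ (i, j) * y $ j))"
    unfolding Uy using D y by (simp add: scalar_prod_def lessThan_atLeast0)
  also have "\<dots> = (\<Sum>i<n. D $$ (i, i) * (y $ i)\<^sup>2)"
  proof (rule sum.cong)
    fix i assume "i \<in> {..<n}"
    then have "(\<Sum>j<n. D $$ (i, j) * y $ j) = (\<Sum>j<n. if i = j then D $$ (i, i) * y $ i else 0)"
      using D by (intro sum.cong) (auto simp: diagonal_mat_def)
    then show "y $ i * (\<Sum>j<n. D $$ (i, j) * y $ j) = D $$ (i, i) * (y $ i)\<^sup>2"
      using \<open>i \<in> {..<n}\<close> by (simp add: power2_eq_square)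
  qed simp
  also have "\<dots> \<le> 0"
  proof (rule sum_nonpos)
    fix i assume "i \<in> {..<n}"
    then show "D $$ (i, i) * (y $ i)\<^sup>2 \<le> 0"
      using y_zero[of i] by (cases "D $$ (i, i) > 0") (auto simp: mult_nonpos_nonneg)
  qed
  finally show False using pos[OF c(1,2)] by simp
qed

section \<open>Block sums and the modularity matrix\<close>

lemma scalar_prod_mult_mat_vec_eq_sum:
  fixes M :: "real mat"
  assumes "M \<in> carrier_mat n n" "x \<in> carrier_vec n"
  shows "x \<bullet> (M *\<^sub>v x) = (\<Sum>i<n. \<Sum>j<n. x $ i * M $$ (i, j) * x $ j)"
  using assms by (simp add: scalar_prod_def lessThan_atLeast0 sum_distrib_left mult.assoc)

definition block_sum :: "'a::comm_monoid_add mat \<Rightarrow> nat set \<Rightarrow> nat set \<Rightarrow> 'a" where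
  "block_sum M S T = (\<Sum>i\<in>S. \<Sum>j\<in>T. M $$ (i, j))"

lemma block_sum_commute:
  assumes "M \<in> carrier_mat n n" "transpose_mat M = M" "S \<subseteq> {..<n}" "T \<subseteq> {..<n}"
  shows "block_sum M S T = block_sum M T S"
proof -
  have "M $$ (i, j) = M $$ (j, i)" if "i \<in> S" "j \<in> T" for i j
  proof -
    have "i < n" "j < n" using that assms(3,4) by auto
    then show ?thesis using arg_cong[OF assms(2), of "\<lambda>A. A $$ (i, j)"] assms(1) by simp
  qed
  then show ?thesis
    unfolding block_sum_def by (subst sum.swap) (auto intro!: sum.cong)
qed

text \<open>
  For the modularity matrix this says that merging two disjoint sets changes the total modularity by
  twice the interaction between them.
\<close>

lemma block_sum_Un_same:
  assumes "M \<in> carrier_mat n n" "transpose_mat M = M" "S \<subseteq> {..<n}" "T \<subseteq> {..<n}" "S \<inter> T = {}"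
  shows "block_sum M (S \<union> T) (S \<union> T) = block_sum M S S + block_sum M T T + 2 * block_sum (M :: real mat) S T"
proof -
  have "finite S" "finite T" using assms(3,4) finite_subset by auto
  then have "block_sum M (S \<union> T) (S \<union> T) =
      block_sum M S S + block_sum M S T + (block_sum M T S + block_sum M T T)"
    using assms(5) by (simp add: block_sum_def sum.union_disjoint sum.distrib)
  then show ?thesis using block_sum_commute[OF assms(1-4)] by simp
qed

lemma modularity_mat_carrier: "modularity_mat n E \<omega> \<in> carrier_mat n n"
  unfolding modularity_mat_def by (intro minus_carrier_mat smult_carrier_mat) simp

lemma modularity_mat_symmetric: "transpose_mat (modularity_mat n E \<omega>) = modularity_mat n E \<omega>"
  by (rule eq_matI) (auto simp: modularity_mat_def adjacency_mat_def insert_commute)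

lemma modularity_eq_block_sum:
  assumes "S \<subseteq> {..<n}"
  shows "modularity n E \<omega> S = block_sum (modularity_mat n E \<omega>) S S"
proof -
  let ?M = "modularity_mat n E \<omega>"
  have S: "(\<Sum>i<n. if i \<in> S then f i else 0) = sum f S" for f :: "nat \<Rightarrow> real"
    using assms by (simp add: sum.inter_restrict[symmetric] Int_absorb1)
  have "modularity n E \<omega> S = (\<Sum>i<n. \<Sum>j<n. char_vec n S $ i * ?M $$ (i, j) * char_vec n S $ j)"
    unfolding modularity_def
    by (rule scalar_prod_mult_mat_vec_eq_sum[OF modularity_mat_carrier]) (simp add: char_vec_def)
  also have "\<dots> = (\<Sum>i<n. if i \<in> S then (\<Sum>j<n. if j \<in> S then ?M $$ (i, j) else 0) else 0)"
    by (intro sum.cong) (auto simp: char_vec_def intro!: sum.cong)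
  finally show ?thesis by (simp add: S block_sum_def)
qed

lemma adjacency_mat_nonneg:
  assumes "connected_weighted_graph n E \<omega>" "i < n" "j < n"
  shows "adjacency_mat n E \<omega> $$ (i, j) \<ge> 0"
  using assms connected_weighted_graph.weight_pos[of n E \<omega> "{i, j}"]
  by (auto simp: adjacency_mat_def)

lemma degree_vec_nonneg:
  assumes "connected_weighted_graph n E \<omega>" "i < n"
  shows "degree_vec n E \<omega> $ i \<ge> 0"
  using assms by (auto simp: degree_vec_def intro!: sum_nonneg adjacency_mat_nonneg)

lemma volume_nonneg:
  assumes "connected_weighted_graph n E \<omega>"
  shows "volume n E \<omega> \<ge> 0"
  unfolding volume_def using assms by (auto intro!: sum_nonneg degree_vec_nonneg)

text \<open>
  The all-ones vector lies in the kernel of the modularity matrix. If the volume is zero, then the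
  quotient by it is zero, but so are all degrees.
\<close>

lemma modularity_mat_row_sum:
  assumes G: "connected_weighted_graph n E \<omega>" and i: "i < n"
  shows "(\<Sum>j<n. modularity_mat n E \<omega> $$ (i, j)) = 0"
proof -
  let ?d = "degree_vec n E \<omega>" and ?v = "volume n E \<omega>"
  have "(\<Sum>j<n. modularity_mat n E \<omega> $$ (i, j)) =
      (\<Sum>j<n. adjacency_mat n E \<omega> $$ (i, j) - 1 / ?v * (?d $ i * ?d $ j))"
    using i by (intro sum.cong) (auto simp: modularity_mat_def adjacency_mat_def)
  also have "\<dots> = ?d $ i - 1 / ?v * ?d $ i * ?v"
  proof -
    have "(\<Sum>j<n. adjacency_mat n E \<omega> $$ (i, j)) = ?d $ i" using i by (simp add: degree_vec_def)
    then show ?thesis by (simp add: sum_subtractf volume_def sum_distrib_left mult.assoc)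
  qed
  also have "\<dots> = 0"
  proof (cases "?v = 0")
    case True
    then have "\<forall>j\<in>{..<n}. ?d $ j = 0"
      unfolding volume_def using degree_vec_nonneg[OF G] by (subst (asm) sum_nonneg_eq_0_iff) auto
    then show ?thesis using i by simp
  qed simp
  finally show ?thesis .
qed

lemma sum_over_partition:
  assumes "partition_on A P" "finite A"
  shows "sum f A = (\<Sum>S\<in>P. sum f S)"
proof -
  have "sum f (\<Union>P) = (sum \<circ> sum) f P"
  proof (rule sum.Union_disjoint)
    show "\<forall>S\<in>P. finite S"
      using assms by (metis Sup_upper finite_subset partition_onD1)
    show "\<forall>S\<in>P. \<forall>T\<in>P. S \<noteq> T \<longrightarrow> S \<inter> T = {}"
      using partition_onD2[OF assms(1)] by (auto simp: disjoint_def)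
  qed
  then show ?thesis using partition_onD1[OF assms(1)] by simp
qed

lemma block_sum_over_partition:
  assumes "partition_on {..<n} P"
  shows "(\<Sum>T\<in>P. block_sum M S T) = (\<Sum>i\<in>S. \<Sum>j<n. M $$ (i, j))"
  unfolding block_sum_def sum_over_partition[OF assms finite_lessThan] by (rule sum.swap)

text \<open>
  The matrix \<open>b\<close> is the Laplacian of a complete graph with positive edge weights \<open>- b S T\<close>,
  so its form is \<open>1/2 \<Sum>S T. - b S T (g S - g T)\<^sup>2\<close> and vanishes on constant functions only.
\<close>

lemma laplacian_form_pos:
  fixes b :: "'a \<Rightarrow> 'a \<Rightarrow> real" and g :: "'a \<Rightarrow> real"
  assumes "finite P"
    and sym: "\<And>S T. S \<in> P \<Longrightarrow> T \<in> P \<Longrightarrow> b S T = b T S"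
    and row_sum: "\<And>S. S \<in> P \<Longrightarrow> (\<Sum>T\<in>P. b S T) = 0"
    and neg: "\<And>S T. S \<in> P \<Longrightarrow> T \<in> P \<Longrightarrow> S \<noteq> T \<Longrightarrow> b S T < 0"
    and nonconst: "S \<in> P" "T \<in> P" "g S \<noteq> g T"
  shows "(\<Sum>S\<in>P. \<Sum>T\<in>P. g S * b S T * g T) > 0"
proof -
  have col_sum: "(\<Sum>S\<in>P. b S T) = 0" if "T \<in> P" for T
    using row_sum[OF that] sym that by (metis (no_types, lifting) sum.cong)
  have 1: "(\<Sum>S\<in>P. \<Sum>T\<in>P. (g S)\<^sup>2 * b S T) = 0"
    by (simp add: sum_distrib_left[symmetric] row_sum)
  have 2: "(\<Sum>S\<in>P. \<Sum>T\<in>P. (g T)\<^sup>2 * b S T) = 0"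
    by (subst sum.swap) (simp add: sum_distrib_left[symmetric] col_sum)
  have "(\<Sum>S\<in>P. \<Sum>T\<in>P. - b S T * (g S - g T)\<^sup>2) =
      (\<Sum>S\<in>P. \<Sum>T\<in>P. 2 * (g S * b S T * g T) - (g S)\<^sup>2 * b S T - (g T)\<^sup>2 * b S T)"
    by (intro sum.cong refl) (simp add: power2_eq_square algebra_simps)
  also have "\<dots> = 2 * (\<Sum>S\<in>P. \<Sum>T\<in>P. g S * b S T * g T)"
    by (simp add: sum_subtractf 1 2 sum_distrib_left)
  finally have eq: "(\<Sum>S\<in>P. \<Sum>T\<in>P. - b S T * (g S - g T)\<^sup>2) =
    2 * (\<Sum>S\<in>P. \<Sum>T\<in>P. g S * b S T * g T)" .
  have nonneg: "- b S T * (g S - g T)\<^sup>2 \<ge> 0" if "S \<in> P" "T \<in> P" for S T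
    using neg[OF that] by (cases "S = T") (auto simp: mult_nonpos_nonneg)
  have "- b S T * (g S - g T)\<^sup>2 > 0"
    using neg[OF nonconst(1,2)] nonconst(3) by (intro mult_pos_pos) auto
  then have "(\<Sum>T\<in>P. - b S T * (g S - g T)\<^sup>2) > 0"
    using nonneg[OF nonconst(1)] by (rule sum_pos2[OF \<open>finite P\<close> nonconst(2)])
  then have "(\<Sum>S\<in>P. \<Sum>T\<in>P. - b S T * (g S - g T)\<^sup>2) > 0"
    by (rule sum_pos2[OF \<open>finite P\<close> nonconst(1)]) (intro sum_nonneg nonneg)
  then show ?thesis using eq by simp
qed

lemma partition_on_merge:
  assumes P: "partition_on A P" "finite A" and ST: "S \<in> P" "T \<in> P" "S \<noteq> T"
  shows "partition_on A (insert (S \<union> T) (P - {S, T}))"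
    and "card (insert (S \<union> T) (P - {S, T})) < card P"
    and "S \<union> T \<notin> P - {S, T}"
proof -
  have disj: "X \<inter> Y = {}" if "X \<in> P" "Y \<in> P" "X \<noteq> Y" for X Y
    using partition_onD2[OF P(1)] that by (auto simp: disjoint_def)
  have ne: "X \<noteq> {}" if "X \<in> P" for X using partition_onD3[OF P(1)] that by auto
  show "partition_on A (insert (S \<union> T) (P - {S, T}))"
  proof (rule partition_onI)
    show "\<Union>(insert (S \<union> T) (P - {S, T})) = A" using partition_onD1[OF P(1)] ST by auto
    show "disjnt X Y" if "X \<in> insert (S \<union> T) (P - {S, T})" "Y \<in> insert (S \<union> T) (P - {S, T})" "X \<noteq> Y" for X Y
      using that disj ST by (auto simp: disjnt_def)
  qed (use ne ST in auto)
  show new: "S \<union> T \<notin> P - {S, T}"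
    using disj[of "S \<union> T" S] ne[OF ST(1)] ST by auto
  have "finite P" using finite_elements[OF P(2,1)] .
  then show "card (insert (S \<union> T) (P - {S, T})) < card P"
    using new ST card_mono[of P "{S, T}"] by (simp add: card_Diff_subset)
qed

text \<open>
  If two blocks of an optimal partition interacted nonnegatively, merging them would yield a partition
  with fewer sets and no smaller modularity, contrary to optimality or minimality. This comparison
  requires that the merged partition is not the trivial one, since the maximum ranges over nontrivial
  partitions. If it is trivial, there are just two blocks; the whole vertex set has modularity zero
  while both blocks have positive modularity, which again makes the interaction negative.
\<close>

lemma block_sum_neg_if_optimal_minimal:
  assumes G: "connected_weighted_graph n E \<omega>"
    and P: "partition_on {..<n} P"
    and max: "partition_modularity n E \<omega> P = max_modularity n E \<omega>"
    and minimal: "\<And>P'. partition_on {..<n} P' \<Longrightarrow>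
           partition_modularity n E \<omega> P' = max_modularity n E \<omega> \<Longrightarrow> card P \<le> card P'"
    and modules: "\<And>S. S \<in> P \<Longrightarrow> is_module n E \<omega> S"
    and ST: "S \<in> P" "T \<in> P" "S \<noteq> T"
  shows "block_sum (modularity_mat n E \<omega>) S T < 0"
proof -
  let ?M = "modularity_mat n E \<omega>" and ?Q = "modularity n E \<omega>"
  define P' where "P' = insert (S \<union> T) (P - {S, T})"
  note merge = partition_on_merge[OF P finite_lessThan ST, folded P'_def]
  have finP: "finite P" using finite_elements[OF finite_lessThan P] .
  have sub: "S \<subseteq> {..<n}" "T \<subseteq> {..<n}" using partition_onD1[OF P] ST by auto
  have "S \<inter> T = {}" using partition_onD2[OF P] ST by (auto simp: disjoint_def)
  then have Q_Un: "?Q (S \<union> T) = ?Q S + ?Q T + 2 * block_sum ?M S T"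
    using block_sum_Un_same[OF modularity_mat_carrier modularity_mat_symmetric sub] sub
    by (simp add: modularity_eq_block_sum)
  have "?Q (S \<union> T) < ?Q S + ?Q T"
  proof (cases "P' = {{..<n}}")
    case True
    then have "S \<union> T = {..<n}" by (auto simp: P'_def)
    then have "?Q (S \<union> T) = 0"
      by (simp add: modularity_eq_block_sum block_sum_def modularity_mat_row_sum[OF G])
    moreover have "?Q S > 0" "?Q T > 0" using modules ST by (auto simp: is_module_def)
    ultimately show ?thesis by simp
  next
    case False
    have "partition_modularity n E \<omega> P' \<le> max_modularity n E \<omega>"
      unfolding max_modularity_def
      using False merge(1) by (intro Max_ge) (auto simp: finitely_many_partition_on)
    moreover have "partition_modularity n E \<omega> P' \<noteq> max_modularity n E \<omega>"
      using minimal[OF merge(1)] merge(2) by auto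
    ultimately have "partition_modularity n E \<omega> P' < partition_modularity n E \<omega> P"
      using max by simp
    then have "(\<Sum>X\<in>P'. ?Q X) < (\<Sum>X\<in>P. ?Q X)"
      unfolding partition_modularity_def using volume_nonneg[OF G]
      by (smt (verit) mult_left_mono divide_nonneg_nonneg)
    moreover have "(\<Sum>X\<in>P'. ?Q X) = ?Q (S \<union> T) + (\<Sum>X\<in>P - {S, T}. ?Q X)"
      unfolding P'_def using merge(3) finP by (subst sum.insert) auto
    moreover have "(\<Sum>X\<in>P. ?Q X) = ?Q S + ?Q T + (\<Sum>X\<in>P - {S, T}. ?Q X)"
      using sum.subset_diff[of "{S, T}" P ?Q] ST finP by simp
    ultimately show ?thesis by simp
  qed
  then show ?thesis using Q_Un by simp
qed

section \<open>The bound on the number of blocks\<close>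

text \<open>
  Positivity on nonconstant functions on the blocks gives a subspace of dimension one less than the
  number of blocks on which \<open>M\<close> is positive definite: the vectors that are constant on each block and
  zero on a chosen block \<open>S0\<close>. Such a vector can only be constant if it is zero. The columns of \<open>W\<close>
  are the indicator vectors of the other blocks.
\<close>

lemma positive_on_block_constant_vectors:
  fixes M :: "real mat"
  assumes P: "partition_on {..<n} P" and "S0 \<in> P" and M: "M \<in> carrier_mat n n"
    and form: "\<And>g. (\<exists>S\<in>P. \<exists>T\<in>P. g S \<noteq> g T) \<Longrightarrow>
      (\<Sum>S\<in>P. \<Sum>T\<in>P. g S * block_sum M S T * g T) > 0"
  obtains W where "W \<in> carrier_mat n (card P - 1)"
    "\<And>c. c \<in> carrier_vec (card P - 1) \<Longrightarrow> c \<noteq> 0\<^sub>v (card P - 1) \<Longrightarrow>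
      (W *\<^sub>v c) \<bullet> (M *\<^sub>v (W *\<^sub>v c)) > 0"
proof -
  define m where "m = card P - 1"
  have finP: "finite P" using finite_elements[OF finite_lessThan P] .
  have "card (P - {S0}) = m" using \<open>S0 \<in> P\<close> finP by (simp add: m_def)
  then obtain h where h: "bij_betw h {..<m} (P - {S0})"
    using ex_bij_betw_nat_finite[of "P - {S0}"] finP by (auto simp: lessThan_atLeast0)
  define W where "W = (mat n m (\<lambda>(i, a). if i \<in> h a then 1 else 0) :: real mat)"
  have W: "W \<in> carrier_mat n m" by (simp add: W_def)
  have "(W *\<^sub>v c) \<bullet> (M *\<^sub>v (W *\<^sub>v c)) > 0" if c: "c \<in> carrier_vec m" "c \<noteq> 0\<^sub>v m" for c
  proof -
    \<comment> \<open>The value of \<open>W c\<close> on the block \<open>S\<close>; at most one summand is nonzero as \<open>h\<close> is injective.\<close>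
    define g where "g S = (\<Sum>a<m. if h a = S then c $ a else 0)" for S
    define x where "x = W *\<^sub>v c"
    have x: "x \<in> carrier_vec n" unfolding x_def by (rule mult_mat_vec_carrier[OF W c(1)])
    have x_block: "x $ i = g S" if "S \<in> P" "i \<in> S" for i S
    proof -
      have i: "i < n" using that partition_onD1[OF P] by auto
      have "i \<in> h a \<longleftrightarrow> h a = S" if "a < m" for a
      proof -
        have "h a \<in> P" using h that by (auto simp: bij_betw_def)
        then show ?thesis
          using \<open>S \<in> P\<close> \<open>i \<in> S\<close> partition_onD2[OF P] by (auto simp: disjoint_def)
      qed
      then show ?thesis
        using i c by (auto simp: x_def W_def g_def scalar_prod_def lessThan_atLeast0 intro!: sum.cong)
    qed
    have "g S0 = 0" unfolding g_def
      using h by (intro sum.neutral) (auto simp: bij_betw_def)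
    moreover obtain a where a: "a < m" "c $ a \<noteq> 0"
      using c by (metis carrier_vecD eq_vecI index_zero_vec)
    moreover have "g (h a) = c $ a"
    proof -
      have "g (h a) = (\<Sum>b<m. if b = a then c $ a else 0)"
        unfolding g_def using h a by (intro sum.cong) (auto simp: bij_betw_def inj_on_def)
      then show ?thesis using a by simp
    qed
    moreover have "h a \<in> P" using h a by (auto simp: bij_betw_def)
    ultimately have "\<exists>S\<in>P. \<exists>T\<in>P. g S \<noteq> g T" using \<open>S0 \<in> P\<close> by metis
    from form[OF this] have pos: "(\<Sum>S\<in>P. \<Sum>T\<in>P. g S * block_sum M S T * g T) > 0" .
    have "x \<bullet> (M *\<^sub>v x) = (\<Sum>i<n. \<Sum>j<n. x $ i * M $$ (i, j) * x $ j)"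
      by (rule scalar_prod_mult_mat_vec_eq_sum[OF M x])
    also have "\<dots> = (\<Sum>S\<in>P. \<Sum>i\<in>S. \<Sum>T\<in>P. \<Sum>j\<in>T. x $ i * M $$ (i, j) * x $ j)"
      unfolding sum_over_partition[OF P finite_lessThan] ..
    also have "\<dots> = (\<Sum>S\<in>P. \<Sum>i\<in>S. \<Sum>T\<in>P. \<Sum>j\<in>T. g S * M $$ (i, j) * g T)"
      by (intro sum.cong refl) (simp add: x_block)
    also have "\<dots> = (\<Sum>S\<in>P. \<Sum>T\<in>P. \<Sum>i\<in>S. \<Sum>j\<in>T. g S * M $$ (i, j) * g T)"
      by (intro sum.cong refl sum.swap)
    also have "\<dots> = (\<Sum>S\<in>P. \<Sum>T\<in>P. g S * block_sum M S T * g T)"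
      by (simp add: block_sum_def sum_distrib_left sum_distrib_right)
    finally show ?thesis using pos by (simp add: x_def)
  qed
  with W that show thesis by (simp add: m_def)
qed

theorem corollary6p3:
  fixes n :: nat and E :: "nat set set" and \<omega> :: "nat set \<Rightarrow> real" and P :: "nat set set"
  assumes "connected_weighted_graph n E \<omega>"
    and "partition_on {..<n} P"
    and "partition_modularity n E \<omega> P = max_modularity n E \<omega>"
    and "\<And>P'. partition_on {..<n} P' \<Longrightarrow>
           partition_modularity n E \<omega> P' = max_modularity n E \<omega> \<Longrightarrow> card P \<le> card P'"
    and "\<And>S. S \<in> P \<Longrightarrow> is_module n E \<omega> S"
  shows "card P \<le> num_pos_eigenvalues (modularity_mat n E \<omega>) + 1"
proof (cases "P = {}")
  case False
  then obtain S0 where S0: "S0 \<in> P" by blast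
  let ?M = "modularity_mat n E \<omega>"
  note P = assms(2)
  have finP: "finite P" using finite_elements[OF finite_lessThan P] .
  have sub: "S \<subseteq> {..<n}" if "S \<in> P" for S using partition_onD1[OF P] that by auto
  have form: "(\<Sum>S\<in>P. \<Sum>T\<in>P. g S * block_sum ?M S T * g T) > 0"
    if nonconst: "\<exists>S\<in>P. \<exists>T\<in>P. g S \<noteq> g T" for g
  proof -
    obtain S T where ST: "S \<in> P" "T \<in> P" "g S \<noteq> g T" using nonconst by blast
    have sym: "block_sum ?M S T = block_sum ?M T S" if "S \<in> P" "T \<in> P" for S T
      using that sub by (intro block_sum_commute[OF modularity_mat_carrier modularity_mat_symmetric])
    have zero: "(\<Sum>T\<in>P. block_sum ?M S T) = 0" if "S \<in> P" for S
      unfolding block_sum_over_partition[OF P]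
      using sub[OF that] by (intro sum.neutral) (auto simp: modularity_mat_row_sum[OF assms(1)])
    show ?thesis
      using finP sym zero block_sum_neg_if_optimal_minimal[OF assms] ST by (rule laplacian_form_pos)
  qed
  obtain W where W: "W \<in> carrier_mat n (card P - 1)"
    and pos: "\<And>c. c \<in> carrier_vec (card P - 1) \<Longrightarrow> c \<noteq> 0\<^sub>v (card P - 1) \<Longrightarrow>
      (W *\<^sub>v c) \<bullet> (?M *\<^sub>v (W *\<^sub>v c)) > 0"
    using positive_on_block_constant_vectors[OF P S0 modularity_mat_carrier form] by blast
  have "card P - 1 \<le> num_pos_eigenvalues ?M"
    by (rule positive_definite_subspace_dim_le[OF modularity_mat_carrier modularity_mat_symmetric W pos])
  then show ?thesis by simp
qed simp

end
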